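(* Suppose an unanticipated shock at date $\tau$ introduces the task-creating technology described in the context, with $0<\Delta<I$, $H>m$ and $$\left(\frac Hm\right)^\Delta\ge 1+\frac{\Delta}{N-I}.$$ Let $(Y_t)_{t\ge\tau}$, $W_\tau$ be output and welfare without the shock, and $(\tilde Y_t)_{t\ge\tau}$, $\tilde W_\tau$ output and welfare with the shock in the full-adoption equilibrium, as defined in the context. Write $1+g=(N-I)^\theta$ and $1+\tilde g=(N-I+\Delta)^\theta$, and assume $\beta(1+\tilde g)<1$. Then: 1. (Immediate adoption gains) $\tilde Y_\tau>Y_\tau$. 2. (Growth acceleration) The growth rate of output is strictly higher at all dates: for all $t\ge\tau$, $\tilde Y_{t+1}/\tilde Y_t=1+\tilde g>1+g=Y_{t+1}/Y_t$. 3. (Welfare gains) $\tilde W_\tau>W_\tau$.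
   Context: Parameters: $\beta\in(0,1)$, $\rho>0$, $m>h>0$, $0<I<N$, $N-I>1$, $\theta\in(0,1)$. At the shock date $\tau$ the CDF of expert skills is exactly Pareto with scale $x_\tau$ and shape $1/\theta$: $F_\tau(q)=1-(q/x_\tau)^{-1/\theta}$ for $q\ge x_\tau$, where $x_\tau>\frac{\rho I}{h^N[(m/h)^I-1]}$. Equilibrium allocations with span of control $\ell>1$ (number of novices hired by each active expert, who all inherit her skill) starting from $F_\tau$: the sequences $\{a_t,F_t\}_{t\ge\tau}$ determined by $1=\ell[1-F_t(a_t)]$ and $F_{t+1}(q)=0$ if $q\le a_t$, $F_{t+1}(q)=\ell[F_t(q)-F_t(a_t)]$ if $q>a_t$. No shock: $\{a_t,F_t\}_{t\ge\tau}$ are the allocations with $\ell=N-I$; $Y_t=m^Ih^{N-I}\int_{a_t}^\infty q\,dF_t(q)$; $S(q)=qm^Ih^{N-I}-\rho I$; $W_\tau=\sum_{j=\tau}^\infty\beta^{j-\tau}\int_{a_j}^\infty S(q)\,dF_j(q)$. Task-creating technology: under it only $I-\Delta$ of the $N$ tasks can be done by machines (productivity $m$, cost $\rho$ each); $N-I$ tasks are done by novices with productivity $h$; $\Delta$ new tasks are done by novices with productivity $H$. In the full-adoption equilibrium every active expert, at every date $t\ge\tau$, uses the new technology with all $I-\Delta$ automatable tasks assigned to machines, so an active expert of skill $q$ produces $qm^{I-\Delta}h^{N-I}H^\Delta$ and hires $N-I+\Delta$ novices. Thus $\{\tilde a_t,\tilde F_t\}_{t\ge\tau}$ are the allocations with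 $\ell=N-I+\Delta$ starting from $\tilde F_\tau=F_\tau$; $\tilde Y_t=m^{I-\Delta}h^{N-I}H^\Delta\int_{\tilde a_t}^\infty q\,d\tilde F_t(q)$; $\tilde S(q)=qm^{I-\Delta}h^{N-I}H^\Delta-\rho(I-\Delta)$; $\tilde W_\tau=\sum_{j=\tau}^\infty\beta^{j-\tau}\int_{\tilde a_j}^\infty\tilde S(q)\,d\tilde F_j(q)$. *)

theory Defs
  imports "HOL-Analysis.Analysis"
begin

definition pareto_cdf :: "real \<Rightarrow> real \<Rightarrow> real \<Rightarrow> real" where
  "pareto_cdf x \<alpha> q = (if x \<le> q then 1 - (q / x) powr (- \<alpha>) else 0)"

definition equilibrium_allocations ::
  "real \<Rightarrow> nat \<Rightarrow> (real \<Rightarrow> real) \<Rightarrow> (nat \<Rightarrow> real) \<Rightarrow> (nat \<Rightarrow> real \<Rightarrow> real) \<Rightarrow> bool" where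
  "equilibrium_allocations l \<tau> F0 a F \<longleftrightarrow>
     F \<tau> = F0 \<and>
     (\<forall>t\<ge>\<tau>. 1 = l * (1 - F t (a t)) \<and>
       (\<forall>q. F (Suc t) q = (if q \<le> a t then 0 else l * (F t q - F t (a t)))))"

text \<open>The integral of \<open>f\<close> against \<open>dF\<close> over the skills above the cutoff \<open>a\<close> is a Lebesgue integral
  for the Lebesgue-Stieltjes measure of the CDF \<open>F\<close>; whether the cutoff itself is included is
  immaterial because the CDFs along an allocation started from a Pareto CDF are continuous.\<close>

definition active_integral :: "(real \<Rightarrow> real) \<Rightarrow> real \<Rightarrow> (real \<Rightarrow> real) \<Rightarrow> real" where
  "active_integral f a F = (LINT q:{a<..}|interval_measure F. f q)"

text \<open>\<open>A\<close> is the output of an active expert per unit of her skill, and \<open>c\<close> is her expenditure on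
  machines.\<close>

definition aggregate_output ::
  "real \<Rightarrow> (nat \<Rightarrow> real) \<Rightarrow> (nat \<Rightarrow> real \<Rightarrow> real) \<Rightarrow> nat \<Rightarrow> real" where
  "aggregate_output A a F t = A * active_integral (\<lambda>q. q) (a t) (F t)"

definition surplus :: "real \<Rightarrow> real \<Rightarrow> real \<Rightarrow> real" where
  "surplus A c q = q * A - c"

definition welfare ::
  "real \<Rightarrow> (real \<Rightarrow> real) \<Rightarrow> (nat \<Rightarrow> real) \<Rightarrow> (nat \<Rightarrow> real \<Rightarrow> real) \<Rightarrow> nat \<Rightarrow> real" where
  "welfare \<beta> S a F \<tau> = (\<Sum>k. \<beta> ^ k * active_integral S (a (\<tau> + k)) (F (\<tau> + k)))"

text \<open>Task counts \<open>N\<close>, \<open>I\<close>, \<open>\<Delta>\<close> are arbitrary reals, so powers with these exponents are written with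
  \<open>powr\<close>; the new technology has \<open>I - \<Delta>\<close> machine tasks, \<open>N - I\<close> novice tasks of productivity \<open>h\<close> and
  \<open>\<Delta>\<close> novice tasks of productivity \<open>H\<close>.\<close>

definition productivity :: "real \<Rightarrow> real \<Rightarrow> real \<Rightarrow> real \<Rightarrow> real" where
  "productivity m h N I = m powr I * h powr (N - I)"

definition new_productivity :: "real \<Rightarrow> real \<Rightarrow> real \<Rightarrow> real \<Rightarrow> real \<Rightarrow> real \<Rightarrow> real" where
  "new_productivity m h H N I \<Delta> = m powr (I - \<Delta>) * h powr (N - I) * H powr \<Delta>"

end

theory Submission
  imports Defs "HOL-Probability.Distribution_Functions"
begin

text \<open>Truncating a Pareto distribution from below yields a Pareto distribution with the same shape.
  Hence along an allocation with span of control \<open>l\<close> the skill distribution stays Pareto and its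
  scale is multiplied by \<open>l powr \<theta>\<close> each period. Output at date \<open>\<tau> + k\<close> is then
  \<open>A * x * l powr (\<theta> * k) * l powr (\<theta> - 1) / (1 - \<theta>)\<close>, and the mass of active experts is \<open>1 / l\<close>. The
  hypothesis on \<open>H / m\<close> says that the productivity ratio is at least the ratio of the spans, so that
  the factor \<open>A * l powr (\<theta> - 1)\<close> increases. Since aggregate spending on machines also falls,
  every term of the welfare series increases.\<close>

section \<open>Power integrals and Pareto distributions\<close>

lemma has_bochner_integral_powr_atLeast:
  fixes c s :: real
  assumes "c > 0" "s < 0"
  shows "has_bochner_integral lborel (\<lambda>q. indicator {c..} q * q powr (s - 1)) (c powr s / (- s))"
proof (rule has_bochner_integral_nn_integral)
  have "(\<integral>\<^sup>+q. ennreal (q powr (s - 1)) * indicator {c..} q \<partial>lborel) = ennreal (0 - c powr s / s)"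
  proof (rule nn_integral_FTC_atLeast)
    \<comment> \<open>The antiderivative vanishes at infinity because \<open>s < 0\<close>, so only
      the boundary term at \<open>c\<close> survives.\<close>
    have "((\<lambda>q::real. q powr s / s) \<longlongrightarrow> 0 / s) at_top"
      using assms by (intro tendsto_divide tendsto_neg_powr tendsto_const filterlim_ident) auto
    then show "((\<lambda>q::real. q powr s / s) \<longlongrightarrow> 0) at_top"
      by simp
  next
    fix q assume "c \<le> q"
    then show "((\<lambda>q. q powr s / s) has_real_derivative q powr (s - 1)) (at q)"
      using assms by (auto intro!: derivative_eq_intros)
  qed auto
  then show "(\<integral>\<^sup>+q. ennreal (indicator {c..} q * q powr (s - 1)) \<partial>lborel) = ennreal (c powr s / (- s))"
    by (simp add: ennreal_mult'' ennreal_indicator[symmetric] mult.commute)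
qed (use assms in \<open>auto simp: divide_nonneg_neg\<close>)

text \<open>The endpoint is a Lebesgue null set. The open half-line is the form that occurs in
  \<open>active_integral\<close> and in upper tail probabilities.\<close>

corollary has_bochner_integral_powr_greaterThan:
  fixes c s :: real
  assumes "c > 0" "s < 0"
  shows "has_bochner_integral lborel (\<lambda>q. indicator {c<..} q * q powr (s - 1)) (c powr s / (- s))"
proof (rule has_bochner_integral_cong_AE[THEN iffD1, OF _ _ _ has_bochner_integral_powr_atLeast[OF assms]])
  show "AE q in lborel. indicator {c..} q * q powr (s - 1) = indicator {c<..} q * q powr (s - 1)"
    using AE_lborel_singleton[of c] by eventually_elim (auto simp: indicator_def)
qed auto

text \<open>Both sides are probability measures with the same CDF. This reduces identifying a
  Stieltjes measure to finding some distribution that has the given CDF.\<close>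

lemma (in real_distribution) interval_measure_cdf: "interval_measure (cdf M) = M"
proof (rule cdf_unique)
  show "real_distribution (interval_measure (cdf M))"
    using cdf_nondecreasing cdf_is_right_cont cdf_lim_at_bot cdf_lim_at_top_prob
    by (rule real_distribution_interval_measure)
  show "cdf (interval_measure (cdf M)) = cdf M"
    using cdf_nondecreasing cdf_is_right_cont cdf_lim_at_bot by (rule cdf_interval_measure)
qed (rule real_distribution_axioms)

text \<open>The derivative of \<open>pareto_cdf x \<alpha>\<close> above \<open>x\<close>, with the
  constant pulled out so that the power integrals apply directly.\<close>

definition pareto_density :: "real \<Rightarrow> real \<Rightarrow> real \<Rightarrow> real" where
  "pareto_density x \<alpha> q = \<alpha> * x powr \<alpha> * (indicator {x..} q * q powr (- \<alpha> - 1))"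

lemma borel_measurable_pareto_density [measurable]: "pareto_density x \<alpha> \<in> borel_measurable borel"
  unfolding pareto_density_def by measurable

text \<open>Multiplying by the density only shifts the exponent, and \<open>p < \<alpha>\<close>
  makes the tail integrable. The case \<open>p = 0\<close> gives tail probabilities and
  \<open>p = 1\<close> the total skill above a cutoff.\<close>

lemma has_bochner_integral_pareto_density:
  assumes "0 < x" "x \<le> c" "0 < \<alpha>" "p < \<alpha>"
  shows "has_bochner_integral (density lborel (pareto_density x \<alpha>)) (\<lambda>q. indicator {c<..} q * q powr p)
    (\<alpha> / (\<alpha> - p) * x powr \<alpha> * c powr (p - \<alpha>))"
proof (rule has_bochner_integral_density)
  have "has_bochner_integral lborel (\<lambda>q. \<alpha> * x powr \<alpha> * (indicator {c<..} q * q powr (p - \<alpha> - 1)))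
    (\<alpha> * x powr \<alpha> * (c powr (p - \<alpha>) / (- (p - \<alpha>))))"
    using assms by (intro has_bochner_integral_mult_right has_bochner_integral_powr_greaterThan) auto
  also have "(\<lambda>q. \<alpha> * x powr \<alpha> * (indicator {c<..} q * q powr (p - \<alpha> - 1))) =
      (\<lambda>q. pareto_density x \<alpha> q *\<^sub>R (indicator {c<..} q * q powr p))"
    using assms by (auto simp: pareto_density_def indicator_def powr_add[symmetric] algebra_simps)
  finally show "has_bochner_integral lborel (\<lambda>q. pareto_density x \<alpha> q *\<^sub>R (indicator {c<..} q * q powr p))
    (\<alpha> / (\<alpha> - p) * x powr \<alpha> * c powr (p - \<alpha>))"
    by simp
qed (use assms in \<open>auto simp: pareto_density_def\<close>)

text \<open>The measure with density \<open>pareto_density\<close> is shown to have CDF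
  \<open>pareto_cdf\<close>; its Stieltjes measure is then itself. Integrals against
  \<open>dF\<close> thus become Lebesgue integrals.\<close>

lemma interval_measure_pareto_cdf:
  assumes "0 < x" "0 < \<alpha>"
  shows "interval_measure (pareto_cdf x \<alpha>) = density lborel (pareto_density x \<alpha>)" (is "_ = ?D")
proof -
  have nonneg: "pareto_density x \<alpha> q \<ge> 0" for q
    using assms by (simp add: pareto_density_def)
  have "has_bochner_integral lborel (pareto_density x \<alpha>) (\<alpha> * x powr \<alpha> * (x powr (- \<alpha>) / (- (- \<alpha>))))"
    unfolding pareto_density_def
    using assms by (intro has_bochner_integral_mult_right has_bochner_integral_powr_atLeast) auto
  also have "\<alpha> * x powr \<alpha> * (x powr (- \<alpha>) / (- (- \<alpha>))) = 1"
    using assms by (simp add: powr_minus)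
  finally have total: "has_bochner_integral lborel (pareto_density x \<alpha>) 1" .
  interpret prob_space ?D
    using total nonneg
    by (intro prob_spaceI) (simp add: emeasure_density nn_integral_eq_integral has_bochner_integral_iff)
  interpret real_distribution ?D
    by unfold_locales simp
  have "cdf ?D q = pareto_cdf x \<alpha> q" for q
  proof (cases "x \<le> q")
    case True
    \<comment> \<open>The moment with exponent 0; \<open>powr 0\<close> equals 1 here because the
      half-line consists of positive numbers.\<close>
    have "has_bochner_integral ?D (indicator {q<..}) ((q / x) powr (- \<alpha>))"
      using has_bochner_integral_pareto_density[OF assms(1) True assms(2), of 0] assms True
      by (rule_tac has_bochner_integral_cong[THEN iffD1])
         (auto simp: indicator_def powr_divide powr_minus field_simps)
    then have "prob {q<..} = (q / x) powr (- \<alpha>)"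
      by (simp add: has_bochner_integral_iff)
    moreover have "- {q<..} = {..q}"
      by auto
    ultimately have "prob {..q} = 1 - (q / x) powr (- \<alpha>)"
      using prob_compl[of "{q<..}"] by (simp add: Compl_eq_Diff_UNIV)
    then show ?thesis
      using True by (simp add: cdf_def pareto_cdf_def)
  next
    case False
    have "emeasure ?D {..q} = (\<integral>\<^sup>+r. ennreal (pareto_density x \<alpha> r) * indicator {..q} r \<partial>lborel)"
      by (rule emeasure_density) auto
    also have "\<dots> = (\<integral>\<^sup>+(r::real). 0 \<partial>lborel)"
      using False by (intro nn_integral_cong) (auto simp: pareto_density_def indicator_def)
    finally show ?thesis
      using False by (simp add: cdf_def pareto_cdf_def measure_def)
  qed
  then have "cdf ?D = pareto_cdf x \<alpha>"
    by blast
  then show ?thesis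
    using interval_measure_cdf by simp
qed

text \<open>The moments \<open>p = 1\<close> and \<open>p = 0\<close> combined linearly. The result
  is written in terms of \<open>c / x\<close> because this ratio is constant along an
  allocation.\<close>

lemma active_integral_surplus_pareto:
  assumes "0 < x" "x \<le> c" "1 < \<alpha>"
  shows "active_integral (surplus A e) c (pareto_cdf x \<alpha>) =
    A * (\<alpha> / (\<alpha> - 1) * x * (c / x) powr (1 - \<alpha>)) - e * (c / x) powr (- \<alpha>)"
proof -
  let ?D = "interval_measure (pareto_cdf x \<alpha>)"
  have D: "has_bochner_integral ?D (\<lambda>q. indicator {c<..} q * q powr p)
      (\<alpha> / (\<alpha> - p) * x powr \<alpha> * c powr (p - \<alpha>))" if "p < \<alpha>" for p
    using has_bochner_integral_pareto_density[of x c \<alpha> p] interval_measure_pareto_cdf[of x \<alpha>] assms that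
    by simp
  have "has_bochner_integral ?D
      (\<lambda>q. A * (indicator {c<..} q * q powr 1) - e * (indicator {c<..} q * q powr 0))
      (A * (\<alpha> / (\<alpha> - 1) * x powr \<alpha> * c powr (1 - \<alpha>)) - e * (\<alpha> / (\<alpha> - 0) * x powr \<alpha> * c powr (0 - \<alpha>)))"
    using assms by (intro has_bochner_integral_diff has_bochner_integral_mult_right D) auto
  also have "(\<lambda>q. A * (indicator {c<..} q * q powr 1) - e * (indicator {c<..} q * q powr 0)) =
      (\<lambda>q. indicator {c<..} q *\<^sub>R surplus A e q)"
    \<comment> \<open>Above \<open>c > 0\<close> the powers with exponents 1 and 0 are
      \<open>q\<close> and 1; elsewhere both sides vanish.\<close>
    using assms by (auto simp: fun_eq_iff indicator_def surplus_def)
  finally have "active_integral (surplus A e) c (pareto_cdf x \<alpha>) =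
      A * (\<alpha> / (\<alpha> - 1) * x powr \<alpha> * c powr (1 - \<alpha>)) - e * (\<alpha> / (\<alpha> - 0) * x powr \<alpha> * c powr (0 - \<alpha>))"
    by (simp add: active_integral_def set_lebesgue_integral_def has_bochner_integral_iff)
  moreover have "x powr \<alpha> * c powr (1 - \<alpha>) = x * (c / x) powr (1 - \<alpha>)"
    using assms by (simp add: powr_divide powr_diff)
  moreover have "x powr \<alpha> * c powr (0 - \<alpha>) = (c / x) powr (- \<alpha>)"
    using assms by (simp add: powr_divide powr_minus field_simps)
  ultimately show ?thesis
    using assms by (simp add: mult.assoc)
qed

section \<open>Allocations from a Pareto start: dynamics, output and welfare\<close>

lemma allocation_cutoff_pareto:
  assumes "l > 1" "x > 0" "\<theta> > 0" and c: "1 = l * (1 - pareto_cdf x (1 / \<theta>) c)"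
  shows "c = x * l powr \<theta>"
proof -
  \<comment> \<open>Below the scale the CDF is 0, which would force \<open>l = 1\<close>.\<close>
  have xc: "x \<le> c"
    using assms by (auto simp: pareto_cdf_def split: if_splits)
  then have "(c / x) powr (- (1 / \<theta>)) = 1 / l"
    using assms by (simp add: pareto_cdf_def field_simps)
  then have "((c / x) powr (- (1 / \<theta>))) powr (- \<theta>) = (1 / l) powr (- \<theta>)"
    by simp
  then have "c / x = l powr \<theta>"
    using assms xc by (simp add: powr_powr powr_divide powr_minus)
  then show ?thesis
    using assms by (simp add: field_simps)
qed

text \<open>The cutoff of each date becomes the scale of the next, hence the exponents
  \<open>k\<close> and \<open>Suc k\<close>.\<close>

lemma equilibrium_allocations_pareto:
  assumes "equilibrium_allocations l \<tau> (pareto_cdf x (1 / \<theta>)) a F" "l > 1" "x > 0" "\<theta> > 0"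
  shows "F (\<tau> + k) = pareto_cdf (x * (l powr \<theta>) ^ k) (1 / \<theta>) \<and> a (\<tau> + k) = x * (l powr \<theta>) ^ Suc k"
proof (induction k)
  case 0
  then show ?case
    using assms allocation_cutoff_pareto[of l x \<theta> "a \<tau>"] by (auto simp: equilibrium_allocations_def)
next
  case (Suc k)
  let ?x = "x * (l powr \<theta>) ^ k" and ?a = "a (\<tau> + k)"
  have x: "?x > 0" and a: "?a = ?x * l powr \<theta>" and F: "F (\<tau> + k) = pareto_cdf ?x (1 / \<theta>)"
    using Suc assms by auto
  have step: "1 = l * (1 - F (\<tau> + k) ?a)"
      "F (Suc (\<tau> + k)) q = (if q \<le> ?a then 0 else l * (F (\<tau> + k) q - F (\<tau> + k) ?a))" for q
    using assms(1) by (auto simp: equilibrium_allocations_def)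
  have l1: "l powr \<theta> > 1"
    using assms by simp
  then have xa: "?x < ?a"
    unfolding a using mult_strict_left_mono[OF l1 x] by simp
  have "F (Suc (\<tau> + k)) q = pareto_cdf ?a (1 / \<theta>) q" for q
  proof (cases "?a < q")
    case True
    \<comment> \<open>The cutoff equation turns \<open>l * (F q - F a)\<close> into 1 minus
      \<open>l\<close> times the upper tail.\<close>
    have "F (Suc (\<tau> + k)) q = 1 - l * (1 - F (\<tau> + k) q)"
      using step True by (simp add: algebra_simps)
    also have "1 - F (\<tau> + k) q = (q / ?x) powr (- (1 / \<theta>))"
      using True xa by (simp add: F pareto_cdf_def)
    also have "q / ?x = q / ?a * l powr \<theta>"
      using a assms by simp
    also have "(q / ?a * l powr \<theta>) powr (- (1 / \<theta>)) = (q / ?a) powr (- (1 / \<theta>)) / l"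
      using assms True x xa by (subst powr_mult) (auto simp: powr_powr powr_minus field_simps)
    finally show ?thesis
      using True assms by (simp add: pareto_cdf_def)
  next
    \<comment> \<open>This case includes \<open>q = ?a\<close>, where \<open>pareto_cdf\<close> with
      scale \<open>?a\<close> also vanishes.\<close>
    case False
    then show ?thesis
      using step x xa by (auto simp: pareto_cdf_def)
  qed
  then have F': "F (Suc (\<tau> + k)) = pareto_cdf (?x * l powr \<theta>) (1 / \<theta>)"
    using a by auto
  have "1 = l * (1 - F (Suc (\<tau> + k)) (a (Suc (\<tau> + k))))"
    using assms(1) unfolding equilibrium_allocations_def by (meson le_SucI le_add1)
  then have "a (Suc (\<tau> + k)) = ?x * l powr \<theta> * l powr \<theta>"
    using F' x assms by (intro allocation_cutoff_pareto) auto
  then show ?case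
    using F' by (simp add: mult_ac)
qed

text \<open>The active mass is \<open>1 / l\<close>, and the mean skill of active experts is the
  cutoff divided by \<open>1 - \<theta>\<close>. Their product yields the factor
  \<open>l powr (\<theta> - 1)\<close>, while \<open>e\<close> is paid by the active mass
  only.\<close>

lemma active_integral_surplus_allocation:
  assumes "equilibrium_allocations l \<tau> (pareto_cdf x (1 / \<theta>)) a F" "l > 1" "x > 0" "0 < \<theta>" "\<theta> < 1"
  shows "active_integral (surplus A e) (a (\<tau> + k)) (F (\<tau> + k)) =
    A * l powr (\<theta> - 1) * (x / (1 - \<theta>)) * (l powr \<theta>) ^ k - e / l"
proof -
  let ?x = "x * (l powr \<theta>) ^ k" and ?a = "a (\<tau> + k)"
  have F: "F (\<tau> + k) = pareto_cdf ?x (1 / \<theta>)" and a: "?a = ?x * l powr \<theta>" and x: "?x > 0"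
    using equilibrium_allocations_pareto[OF assms(1-4), of k] assms by auto
  have "l powr \<theta> \<ge> 1"
    using assms by (simp add: ge_one_powr_ge_zero)
  then have "?x \<le> ?a"
    unfolding a using x by (simp add: mult_le_cancel_left1)
  moreover have "?a / ?x = l powr \<theta>"
    unfolding a using x by (metis less_irrefl nonzero_mult_div_cancel_left)
  moreover have "1 / \<theta> > 1"
    using assms by simp
  ultimately have "active_integral (surplus A e) ?a (F (\<tau> + k)) =
    A * ((1 / \<theta>) / (1 / \<theta> - 1) * ?x * (l powr \<theta>) powr (1 - 1 / \<theta>)) - e * (l powr \<theta>) powr (- (1 / \<theta>))"
    using active_integral_surplus_pareto[OF x, of ?a "1 / \<theta>" A e] by (simp only: F)
  also have "(1 / \<theta>) / (1 / \<theta> - 1) = 1 / (1 - \<theta>)"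
    using assms by (simp add: field_simps)
  also have "(l powr \<theta>) powr (1 - 1 / \<theta>) = l powr (\<theta> - 1)"
    using assms by (simp add: powr_powr algebra_simps)
  also have "(l powr \<theta>) powr (- (1 / \<theta>)) = 1 / l"
    using assms by (simp add: powr_powr powr_minus divide_inverse)
  finally show ?thesis
    by (simp add: mult_ac)
qed

lemma aggregate_output_allocation:
  assumes "equilibrium_allocations l \<tau> (pareto_cdf x (1 / \<theta>)) a F" "l > 1" "x > 0" "0 < \<theta>" "\<theta> < 1"
  shows "aggregate_output A a F (\<tau> + k) = A * l powr (\<theta> - 1) * (x / (1 - \<theta>)) * (l powr \<theta>) ^ k"
proof -
  have "surplus 1 0 = (\<lambda>q. q)"
    by (simp add: surplus_def fun_eq_iff)
  then show ?thesis
    using active_integral_surplus_allocation[OF assms, of 1 0 k] by (simp add: aggregate_output_def)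
qed

text \<open>A difference of two geometric series: discounted output has ratio
  \<open>\<beta> * l powr \<theta>\<close>, and the machine expenditure, constant over time, has
  ratio \<open>\<beta>\<close>.\<close>

lemma welfare_allocation:
  assumes "equilibrium_allocations l \<tau> (pareto_cdf x (1 / \<theta>)) a F" "l > 1" "x > 0" "0 < \<theta>" "\<theta> < 1"
    and "0 < \<beta>" "\<beta> < 1" "\<beta> * l powr \<theta> < 1"
  shows "welfare \<beta> (surplus A e) a F \<tau> =
      A * l powr (\<theta> - 1) * (x / (1 - \<theta>)) / (1 - \<beta> * l powr \<theta>) - e / l / (1 - \<beta>)"
proof -
  have "(\<lambda>k. A * l powr (\<theta> - 1) * (x / (1 - \<theta>)) * (\<beta> * l powr \<theta>) ^ k - e / l * \<beta> ^ k) sums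
      (A * l powr (\<theta> - 1) * (x / (1 - \<theta>)) * (1 / (1 - \<beta> * l powr \<theta>)) - e / l * (1 / (1 - \<beta>)))"
    using assms by (intro sums_diff sums_mult geometric_sums) (auto simp: abs_mult)
  also have "(\<lambda>k. A * l powr (\<theta> - 1) * (x / (1 - \<theta>)) * (\<beta> * l powr \<theta>) ^ k - e / l * \<beta> ^ k) =
      (\<lambda>k. \<beta> ^ k * active_integral (surplus A e) (a (\<tau> + k)) (F (\<tau> + k)))"
    unfolding active_integral_surplus_allocation[OF assms(1-5)]
    by (simp only: power_mult_distrib right_diff_distrib mult_ac)
  finally have "(\<lambda>k. \<beta> ^ k * active_integral (surplus A e) (a (\<tau> + k)) (F (\<tau> + k))) sums
      (A * l powr (\<theta> - 1) * (x / (1 - \<theta>)) * (1 / (1 - \<beta> * l powr \<theta>)) - e / l * (1 / (1 - \<beta>)))" .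
  then show ?thesis
    unfolding welfare_def by (simp add: sums_iff)
qed

section \<open>Comparison of the two technologies\<close>

theorem proposition6:
  fixes \<beta> \<rho> m h H N I \<Delta> \<theta> x g g' :: real
    and \<tau> :: nat
    and a a' :: "nat \<Rightarrow> real"
    and F F' :: "nat \<Rightarrow> real \<Rightarrow> real"
    and Y Y' :: "nat \<Rightarrow> real"
    and W W' :: real
  assumes "0 < \<beta>" "\<beta> < 1" and "0 < \<rho>" and "0 < h" "h < m"
    and "0 < I" "I < N" "N - I > 1" and "0 < \<theta>" "\<theta> < 1"
    and "x > \<rho> * I / (h powr N * ((m / h) powr I - 1))"
    and "0 < \<Delta>" "\<Delta> < I" and "H > m"
    and "(H / m) powr \<Delta> \<ge> 1 + \<Delta> / (N - I)"
    and "equilibrium_allocations (N - I) \<tau> (pareto_cdf x (1 / \<theta>)) a F"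
    and "\<And>t. t \<ge> \<tau> \<Longrightarrow> Y t = aggregate_output (productivity m h N I) a F t"
    and "W = welfare \<beta> (surplus (productivity m h N I) (\<rho> * I)) a F \<tau>"
    and "equilibrium_allocations (N - I + \<Delta>) \<tau> (pareto_cdf x (1 / \<theta>)) a' F'"
    and "\<And>t. t \<ge> \<tau> \<Longrightarrow> Y' t = aggregate_output (new_productivity m h H N I \<Delta>) a' F' t"
    and "W' = welfare \<beta> (surplus (new_productivity m h H N I \<Delta>) (\<rho> * (I - \<Delta>))) a' F' \<tau>"
    and "1 + g = (N - I) powr \<theta>"
    and "1 + g' = (N - I + \<Delta>) powr \<theta>"
    and "\<beta> * (1 + g') < 1"
  shows "Y' \<tau> > Y \<tau> \<and>
    (\<forall>t\<ge>\<tau>. Y' (Suc t) / Y' t = 1 + g' \<and> 1 + g' > 1 + g \<and> 1 + g = Y (Suc t) / Y t) \<and>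
    W' > W"
proof -
  note alloc = assms(16) and alloc' = assms(19)
  define l l' A A' where defs: "l = N - I" "l' = N - I + \<Delta>"
    "A = productivity m h N I" "A' = new_productivity m h H N I \<Delta>"
  have l: "1 < l" "l < l'" and l': "1 < l'"
    using assms by (auto simp: defs)
  have "1 < (m / h) powr I"
    using assms by simp
  \<comment> \<open>The assumed lower bound on \<open>x\<close> is itself positive, which makes the
    Pareto scale positive.\<close>
  then have "0 < \<rho> * I / (h powr N * ((m / h) powr I - 1))"
    using assms by simp
  then have x: "0 < x"
    using assms by linarith
  have growth: "l powr \<theta> < l' powr \<theta>"
    using l assms by (intro powr_less_mono2) auto
  have A: "A > 0"
    using assms by (simp add: defs productivity_def)
  have "A' = A * (H / m) powr \<Delta>"
    using assms by (simp add: defs productivity_def new_productivity_def powr_diff powr_divide)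
  \<comment> \<open>Here \<open>l' / l\<close> is \<open>1 + \<Delta> / (N - I)\<close>, the ratio
    of the spans of control.\<close>
  moreover have "(H / m) powr \<Delta> \<ge> l' / l"
    using assms by (simp add: defs field_simps)
  ultimately have "A' \<ge> A * (l' / l)"
    using mult_left_mono[of "l' / l" "(H / m) powr \<Delta>" A] A by linarith
  then have "A' * l' powr (\<theta> - 1) \<ge> A * (l' / l) * l' powr (\<theta> - 1)"
    by (intro mult_right_mono) auto
  also have "A * (l' / l) * l' powr (\<theta> - 1) = A * l' powr \<theta> / l"
    using l l' by (simp add: powr_diff)
  finally have "A' * l' powr (\<theta> - 1) \<ge> A * l' powr \<theta> / l" .
  \<comment> \<open>Strictness comes from faster growth, so it holds even if the bound on
    \<open>H / m\<close> is attained.\<close>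
  moreover have "A * l powr (\<theta> - 1) < A * l' powr \<theta> / l"
    using l A growth by (simp add: powr_diff divide_strict_right_mono)
  ultimately have B: "A * l powr (\<theta> - 1) < A' * l' powr (\<theta> - 1)"
    by linarith
  define K where "K = x / (1 - \<theta>)"
  have K: "K > 0"
    using x assms by (simp add: K_def)
  have BK: "0 < A * l powr (\<theta> - 1) * K" "A * l powr (\<theta> - 1) * K < A' * l' powr (\<theta> - 1) * K"
    using A l B K by auto
  have Y: "Y (\<tau> + k) = A * l powr (\<theta> - 1) * K * (l powr \<theta>) ^ k" for k
    using aggregate_output_allocation[OF alloc _ x] assms by (simp add: defs K_def)
  have Y': "Y' (\<tau> + k) = A' * l' powr (\<theta> - 1) * K * (l' powr \<theta>) ^ k" for k
    using aggregate_output_allocation[OF alloc' _ x] assms by (simp add: defs K_def)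
  have "Y \<tau> < Y' \<tau>"
    using Y[of 0] Y'[of 0] BK by simp
  moreover have "Y' (Suc t) / Y' t = 1 + g' \<and> 1 + g' > 1 + g \<and> 1 + g = Y (Suc t) / Y t" if ge: "t \<ge> \<tau>" for t
  proof -
    obtain k where t: "t = \<tau> + k"
      using le_Suc_ex[OF ge] by auto
    have ratio: "c * b ^ Suc k / (c * b ^ k) = b" if "0 < c" "0 < b" for b c :: real
      using that by simp
    have "Y (Suc t) / Y t = l powr \<theta>"
      unfolding t add_Suc_right[symmetric] Y using BK l by (intro ratio) auto
    moreover have "Y' (Suc t) / Y' t = l' powr \<theta>"
      unfolding t add_Suc_right[symmetric] Y' using BK l by (intro ratio) auto
    ultimately show ?thesis
      using growth assms(22,23) by (simp add: defs)
  qed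
  moreover have "W < W'"
  proof -
    have disc': "\<beta> * l' powr \<theta> < 1"
      using assms by (simp add: defs)
    have disc: "\<beta> * l powr \<theta> < \<beta> * l' powr \<theta>"
      using growth assms by simp
    \<comment> \<open>The numerator rises with initial output, and the positive denominator falls as
      growth accelerates.\<close>
    have "A * l powr (\<theta> - 1) * K / (1 - \<beta> * l powr \<theta>) < A' * l' powr (\<theta> - 1) * K / (1 - \<beta> * l' powr \<theta>)"
      using BK disc disc' by (intro frac_less) auto
    \<comment> \<open>Each active expert uses fewer machines, and fewer experts are active.\<close>
    moreover have "\<rho> * (I - \<Delta>) / l' / (1 - \<beta>) \<le> \<rho> * I / l / (1 - \<beta>)"
      using assms l by (intro divide_right_mono frac_le mult_left_mono) auto
    moreover have "W = A * l powr (\<theta> - 1) * K / (1 - \<beta> * l powr \<theta>) - \<rho> * I / l / (1 - \<beta>)"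
      using welfare_allocation[OF alloc _ x] assms less_trans[OF disc disc'] by (simp add: defs K_def)
    moreover have "W' = A' * l' powr (\<theta> - 1) * K / (1 - \<beta> * l' powr \<theta>) - \<rho> * (I - \<Delta>) / l' / (1 - \<beta>)"
      using welfare_allocation[OF alloc' _ x] assms disc' by (simp add: defs K_def)
    ultimately show ?thesis
      by linarith
  qed
  ultimately show ?thesis
    by blast
qed

end
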